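(* Let $n\ge 1$. The characteristic polynomial of the homogenized Shi arrangement $\mathcal{HS}_{2n-1}$ is $$\chi_{\mathcal{HS}_{2n-1}}(t)=t\prod_{i=1}^{n-1}(t-i)^2.$$
   Context: $\mathcal{HS}_{2n-1}$ is the hyperplane arrangement in $\mathbb R^{2n-1}$ with coordinates $(x_1,\dots,x_n,y_1,\dots,y_{n-1})$ given by $\{x_i-x_j=0:1\le i<j\le n\}\cup\{x_i-x_j=y_i:1\le i<j\le n\}$. For a real arrangement $\mathcal A$ in $\mathbb R^d$ with intersection poset $\mathcal L(\mathcal A)$ (nonempty intersections of hyperplanes including $\mathbb R^d$, ordered by reverse inclusion) and Möbius function $\mu$, the characteristic polynomial of the arrangement is $\chi_{\mathcal A}(t)=\sum_{X\in\mathcal L(\mathcal A)}\mu(\mathbb R^d,X)\,t^{\dim X}$. *)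

theory Defs
  imports "HOL-Analysis.Analysis" "HOL-Computational_Algebra.Polynomial"
begin

text \<open>Posets are given, as in \<open>HOL.Order_Relation\<close>, by their order relation \<open>r\<close>,
  where \<open>(x, y) \<in> r\<close> means that \<open>x\<close> is below \<open>y\<close> and \<open>Field r\<close> is the underlying set.\<close>

definition locally_finite_order :: "'a rel \<Rightarrow> bool" where
  "locally_finite_order r \<longleftrightarrow> Partial_order r \<and> (\<forall>x y. finite {z. (x, z) \<in> r \<and> (z, y) \<in> r})"

text \<open>The value \<open>0\<close> outside locally finite posets only makes the recursion total.\<close>

function moebius :: "'a rel \<Rightarrow> 'a \<Rightarrow> 'a \<Rightarrow> int" where
  "moebius r x y =
     (if locally_finite_order r \<and> (x, y) \<in> r
      then if x = y then 1
           else - (\<Sum>z \<in> {z. (x, z) \<in> r \<and> (z, y) \<in> r \<and> z \<noteq> y}. moebius r x z)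
      else 0)"
  by pat_completeness auto
termination
proof (relation "Wellfounded.measure (\<lambda>(r, x, y). card {z. (x, z) \<in> r \<and> (z, y) \<in> r})", goal_cases)
  case 1
  show ?case by simp
next
  case (2 r x y z)
  then have r: "Partial_order r" and fin: "finite {w. (x, w) \<in> r \<and> (w, y) \<in> r}"
    and z: "(x, z) \<in> r" "(z, y) \<in> r" "z \<noteq> y" and xy: "(x, y) \<in> r"
    by (auto simp: locally_finite_order_def)
  from r have t: "trans r" and a: "antisym r" and f: "refl_on (Field r) r"
    by (auto simp: partial_order_on_def preorder_on_def)
  have "(y, y) \<in> r" using f xy by (auto simp: refl_on_def Field_def)
  moreover have "(y, z) \<notin> r" using a z by (auto dest: antisymD)
  ultimately have "{w. (x, w) \<in> r \<and> (w, z) \<in> r} \<subset> {w. (x, w) \<in> r \<and> (w, y) \<in> r}"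
    using xy z t by (auto dest: transD)
  from psubset_card_mono[OF fin this] show ?case by simp
qed

declare moebius.simps [simp del]

text \<open>The member \<open>UNIV\<close> (the ambient space) is the intersection of the empty subfamily.\<close>

definition intersection_poset :: "'a set set \<Rightarrow> 'a set set" where
  "intersection_poset A = {X. X \<noteq> {} \<and> (\<exists>B\<subseteq>A. X = \<Inter>B)}"

definition reverse_inclusion :: "'a set set \<Rightarrow> 'a set rel" where
  "reverse_inclusion L = {(X, Y). X \<in> L \<and> Y \<in> L \<and> Y \<subseteq> X}"

text \<open>The members of the intersection poset are nonempty affine subspaces, whose dimension is
  \<open>aff_dim\<close>; it is nonnegative, so \<open>nat\<close> does not truncate.\<close>

definition characteristic_poly :: "'a::euclidean_space set set \<Rightarrow> int poly" where
  "characteristic_poly A =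
     (\<Sum>X \<in> intersection_poset A.
        monom (moebius (reverse_inclusion (intersection_poset A)) UNIV X) (nat (aff_dim X)))"

text \<open>The bijection \<open>c\<close> from \<open>{1..2 * n - 1}\<close> onto the index type \<open>'d\<close> lists the coordinates in
  the order \<open>x\<^sub>1, \<dots>, x\<^sub>n, y\<^sub>1, \<dots>, y\<^bsub>n-1\<^esub>\<close>, i.e.
  \<open>x\<^sub>i = v $ c i\<close> and \<open>y\<^sub>i = v $ c (n + i)\<close>.\<close>

definition homogenized_shi :: "nat \<Rightarrow> (nat \<Rightarrow> 'd::finite) \<Rightarrow> (real ^ 'd) set set" where
  "homogenized_shi n c =
     {{v. v $ c i - v $ c j = 0} | i j. 1 \<le> i \<and> i < j \<and> j \<le> n} \<union>
     {{v. v $ c i - v $ c j = v $ c (n + i)} | i j. 1 \<le> i \<and> i < j \<and> j \<le> n}"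

lemma locally_finite_order_intersection_poset:
  assumes "finite A"
  shows "locally_finite_order (reverse_inclusion (intersection_poset A))"
proof -
  let ?L = "intersection_poset A"
  have "?L \<subseteq> Inter ` Pow A" by (auto simp: intersection_poset_def)
  then have "finite ?L" using assms by (meson finite_Pow_iff finite_imageI finite_subset)
  then have "finite {Z. (X, Z) \<in> reverse_inclusion ?L \<and> (Z, Y) \<in> reverse_inclusion ?L}" for X Y
    by (rule rev_finite_subset) (auto simp: reverse_inclusion_def)
  moreover have "Partial_order (reverse_inclusion ?L)"
    unfolding partial_order_on_def preorder_on_def
    by (auto simp: reverse_inclusion_def Field_def intro!: refl_onI transI antisymI)
  ultimately show ?thesis by (simp add: locally_finite_order_def)
qed

lemma finite_homogenized_shi: "finite (homogenized_shi n c)"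
proof -
  have "homogenized_shi n c \<subseteq>
      (\<lambda>(i, j). {v. v $ c i - v $ c j = 0}) ` ({..n} \<times> {..n}) \<union>
      (\<lambda>(i, j). {v. v $ c i - v $ c j = v $ c (n + i)}) ` ({..n} \<times> {..n})"
    unfolding homogenized_shi_def by (fastforce simp: image_iff)
  then show ?thesis by (rule finite_subset) auto
qed

end

theory Submission
  imports Defs
begin

text \<open>By Whitney's theorem the characteristic polynomial is an alternating sum over subfamilies.
  Suppose that \<open>k\<close> hyperplanes, all transversal to a direction \<open>e\<close> that lies in every member of
  \<open>A\<close>, are added to \<open>A\<close>, and that any two of them meet inside a member of \<open>A\<close>. Then the
  subfamilies with two or more of the new hyperplanes cancel, and each new hyperplane lowers the
  dimension by one, so that the polynomial gets multiplied by \<open>(t - k) / t\<close>. The homogenized Shi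
  arrangement is built up in this way along the coordinates \<open>x\<^bsub>n-1\<^esub>, \<dots>, x\<^sub>1\<close> and then
  \<open>y\<^bsub>n-1\<^esub>, \<dots>, y\<^sub>1\<close>: the hyperplanes added for \<open>x\<^sub>i\<close>, and likewise those for \<open>y\<^sub>i\<close>, meet pairwise
  inside some \<open>x\<^sub>j = x\<^sub>k\<close> with \<open>i < j < k\<close>.\<close>

section \<open>Whitney's theorem\<close>

lemma finite_intersection_poset:
  assumes "finite A"
  shows "finite (intersection_poset A)"
proof -
  have "intersection_poset A \<subseteq> Inter ` Pow A"
    by (auto simp: intersection_poset_def)
  then show ?thesis
    using assms by (meson finite_Pow_iff finite_imageI finite_subset)
qed

text \<open>Fix \<open>a\<close> in \<open>A\<close>: the subsets without \<open>a\<close> and those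
  with \<open>a\<close> are in bijection and carry opposite signs.\<close>

lemma sum_Pow_minus_one_power_card:
  assumes "finite A"
  shows "(\<Sum>B\<in>Pow A. (- 1) ^ card B) = (if A = {} then 1 else 0 :: int)"
proof (cases "A = {}")
  case False
  then obtain a where a: "a \<in> A" by blast
  define A' where "A' = A - {a}"
  have A: "A = insert a A'" "a \<notin> A'" and fin: "finite A'"
    using a assms by (auto simp: A'_def)
  have inj: "inj_on (insert a) (Pow A')"
    using A(2) by (intro inj_onI) (metis Pow_iff insert_ident subsetD)
  have card: "card (insert a B) = Suc (card B)" if "B \<in> Pow A'" for B
    using that A(2) fin by (metis Pow_iff card_insert_disjoint finite_subset subsetD)
  have "(\<Sum>B\<in>Pow A. (- 1 :: int) ^ card B) =
      (\<Sum>B\<in>Pow A'. (- 1) ^ card B) + (\<Sum>B\<in>insert a ` Pow A'. (- 1) ^ card B)"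
    unfolding A(1) Pow_insert using A(2) fin by (intro sum.union_disjoint) auto
  also have "\<dots> = 0"
    by (simp add: sum.reindex[OF inj] card sum_negf)
  finally show ?thesis using False by simp
qed simp

text \<open>The alternating sum satisfies the recursion of the Moebius function: summed over all
  flats containing \<open>X\<close>, it runs over all subfamilies of the hyperplanes containing
  \<open>X\<close>, and so vanishes unless \<open>X = UNIV\<close>. The induction is on the number
  of flats containing \<open>X\<close>.\<close>

lemma moebius_intersection_poset:
  fixes A :: "'a set set"
  assumes fin: "finite A" and univ: "UNIV \<notin> A" and "X \<in> intersection_poset A"
  shows "moebius (reverse_inclusion (intersection_poset A)) UNIV X =
    (\<Sum>B | B \<subseteq> A \<and> \<Inter>B = X. (- 1) ^ card B)"
  using assms(3)
proof (induction "card {Z \<in> intersection_poset A. X \<subseteq> Z}" arbitrary: X rule: less_induct)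
  case less
  define L where "L = intersection_poset A"
  define g where "g X = (\<Sum>B | B \<subseteq> A \<and> \<Inter>B = X. (- 1 :: int) ^ card B)" for X
  have finL: "finite L"
    using finite_intersection_poset[OF fin] by (simp add: L_def)
  have X: "X \<in> L" "X \<noteq> {}"
    using less.prems by (auto simp: L_def intersection_poset_def)
  have UL: "UNIV \<in> L"
    unfolding L_def intersection_poset_def by auto
  let ?U = "{Z \<in> L. X \<subseteq> Z}"
  have "(\<Sum>Z\<in>?U. g Z) = (\<Sum>Z\<in>?U. \<Sum>B | B \<in> Pow {H \<in> A. X \<subseteq> H} \<and> \<Inter>B = Z. (- 1) ^ card B)"
    unfolding g_def by (intro sum.cong refl) auto
  also have "\<dots> = (\<Sum>B\<in>Pow {H \<in> A. X \<subseteq> H}. (- 1) ^ card B)"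
  proof (rule sum.group)
    \<comment> \<open>These intersections contain the nonempty set \<open>X\<close>, so they are
      members of the poset.\<close>
    show "Inter ` Pow {H \<in> A. X \<subseteq> H} \<subseteq> ?U"
    proof (rule image_subsetI)
      fix B assume "B \<in> Pow {H \<in> A. X \<subseteq> H}"
      then have "B \<subseteq> A" "X \<subseteq> \<Inter>B" by blast+
      moreover from this X(2) have "\<Inter>B \<noteq> {}" by blast
      ultimately show "\<Inter>B \<in> ?U"
        unfolding L_def intersection_poset_def by blast
    qed
  qed (use fin finL in simp_all)
  also have "\<dots> = (if {H \<in> A. X \<subseteq> H} = {} then 1 else 0)"
    using fin by (intro sum_Pow_minus_one_power_card) simp
  also have "{H \<in> A. X \<subseteq> H} = {} \<longleftrightarrow> X = UNIV"
  proof
    assume "{H \<in> A. X \<subseteq> H} = {}"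
    moreover obtain B where "B \<subseteq> A" "X = \<Inter>B"
      using X by (auto simp: L_def intersection_poset_def)
    ultimately have "B = {}" by blast
    with \<open>X = \<Inter>B\<close> show "X = UNIV" by simp
  qed (use univ in \<open>auto simp: top.extremum_unique\<close>)
  finally have total: "(\<Sum>Z\<in>?U. g Z) = (if X = UNIV then 1 else 0)" .
  have split: "(\<Sum>Z\<in>?U. g Z) = g X + (\<Sum>Z\<in>?U - {X}. g Z)"
    using finL X by (intro sum.remove) auto
  have below: "moebius (reverse_inclusion L) UNIV Z = g Z" if "Z \<in> L" "X \<subset> Z" for Z
  proof -
    have "{W \<in> L. Z \<subseteq> W} \<subset> ?U"
      using that X by auto
    then have "card {W \<in> L. Z \<subseteq> W} < card ?U"
      using finL by (intro psubset_card_mono) auto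
    then show ?thesis
      using less.hyps[of Z] that(1) by (simp add: L_def g_def)
  qed
  have lf: "locally_finite_order (reverse_inclusion L)"
    using locally_finite_order_intersection_poset[OF fin] by (simp add: L_def)
  have "moebius (reverse_inclusion L) UNIV X =
      (if X = UNIV then 1 else - (\<Sum>Z\<in>?U - {X}. moebius (reverse_inclusion L) UNIV Z))"
  proof -
    have "{Z. (UNIV, Z) \<in> reverse_inclusion L \<and> (Z, X) \<in> reverse_inclusion L \<and> Z \<noteq> X} = ?U - {X}"
      using UL X by (auto simp: reverse_inclusion_def)
    then show ?thesis
      using lf UL X by (subst moebius.simps) (auto simp: reverse_inclusion_def)
  qed
  also have "(\<Sum>Z\<in>?U - {X}. moebius (reverse_inclusion L) UNIV Z) = (\<Sum>Z\<in>?U - {X}. g Z)"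
    using below by (intro sum.cong) auto
  also have "(if X = UNIV then 1 else - (\<Sum>Z\<in>?U - {X}. g Z)) = g X"
  proof (cases "X = UNIV")
    case True
    then have "?U - {X} = {}" by auto
    then have "(\<Sum>Z\<in>?U - {X}. g Z) = 0" by (metis sum.empty)
    with total split True show ?thesis by simp
  qed (use total split in simp)
  finally show ?case by (simp add: L_def g_def)
qed

lemma characteristic_poly_Whitney:
  assumes fin: "finite A" and univ: "UNIV \<notin> A"
  shows "characteristic_poly A =
    (\<Sum>B | B \<subseteq> A \<and> \<Inter>B \<noteq> {}. monom ((- 1) ^ card B) (nat (aff_dim (\<Inter>B))))"
proof -
  let ?S = "{B. B \<subseteq> A \<and> \<Inter>B \<noteq> {}}"
  have "characteristic_poly A = (\<Sum>X\<in>intersection_poset A.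
      \<Sum>B | B \<in> ?S \<and> \<Inter>B = X. monom ((- 1) ^ card B) (nat (aff_dim (\<Inter>B))))"
    unfolding characteristic_poly_def
  proof (intro sum.cong refl)
    fix X assume X: "X \<in> intersection_poset A"
    then have "X \<noteq> {}" by (simp add: intersection_poset_def)
    then have S: "{B. B \<in> ?S \<and> \<Inter>B = X} = {B. B \<subseteq> A \<and> \<Inter>B = X}" by auto
    show "monom (moebius (reverse_inclusion (intersection_poset A)) UNIV X) (nat (aff_dim X)) =
        (\<Sum>B | B \<in> ?S \<and> \<Inter>B = X. monom ((- 1) ^ card B) (nat (aff_dim (\<Inter>B))))"
      unfolding S moebius_intersection_poset[OF fin univ X] by (simp add: monom_sum)
  qed
  also have "\<dots> = (\<Sum>B\<in>?S. monom ((- 1) ^ card B) (nat (aff_dim (\<Inter>B))))"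
    using fin finite_intersection_poset[OF fin]
    by (intro sum.group) (auto simp: intersection_poset_def)
  finally show ?thesis .
qed

section \<open>Adding hyperplanes transversal to a direction\<close>

text \<open>The Whitney sum of \<open>A\<close> restricted to \<open>S\<close>. It is indexed by
  subfamilies of \<open>A\<close> itself, so members of \<open>A\<close> with the same trace on
  \<open>S\<close> still count separately; this makes deletion-restriction a plain splitting of the
  sum.\<close>

definition whitney_poly :: "'a::euclidean_space set \<Rightarrow> 'a set set \<Rightarrow> int poly" where
  "whitney_poly S A = (\<Sum>B\<in>Pow A. monom ((- 1) ^ card B) (dim (S \<inter> \<Inter>B)))"

text \<open>Every intersection contains the origin, so no subfamily drops out of Whitney's sum and
  \<open>aff_dim\<close> is \<open>dim\<close>.\<close>

lemma characteristic_poly_central: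
  assumes "finite A" "UNIV \<notin> A" and sub: "\<And>H. H \<in> A \<Longrightarrow> subspace H"
  shows "characteristic_poly A = whitney_poly UNIV A"
proof -
  have B: "\<Inter>B \<noteq> {} \<and> nat (aff_dim (\<Inter>B)) = dim (\<Inter>B)" if "B \<subseteq> A" for B
  proof -
    have "subspace (\<Inter>B)"
      using that sub by (intro subspace_Inter) auto
    moreover from this have "\<Inter>B \<noteq> {}"
      using subspace_0 by fastforce
    ultimately show ?thesis by (simp add: aff_dim_subspace)
  qed
  then have "{B. B \<subseteq> A \<and> \<Inter>B \<noteq> {}} = Pow A" by auto
  then show ?thesis
    unfolding characteristic_poly_Whitney[OF assms(1,2)] whitney_poly_def
    using B by (intro sum.cong) auto
qed

text \<open>Deletion-restriction: the subfamilies containing \<open>H\<close> gain a sign and have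
  their intersection cut by \<open>H\<close>.\<close>

lemma whitney_poly_insert:
  assumes fin: "finite A" and H: "H \<notin> A"
  shows "whitney_poly S (insert H A) = whitney_poly S A - whitney_poly (S \<inter> H) A"
proof -
  have inj: "inj_on (insert H) (Pow A)"
    using H by (intro inj_onI) (metis Pow_iff insert_ident subsetD)
  have card: "card (insert H B) = Suc (card B)" if "B \<in> Pow A" for B
    using that H fin by (metis Pow_iff card_insert_disjoint finite_subset subsetD)
  have "whitney_poly S (insert H A) = whitney_poly S A +
      (\<Sum>B\<in>insert H ` Pow A. monom ((- 1) ^ card B) (dim (S \<inter> \<Inter>B)))"
    unfolding whitney_poly_def Pow_insert using H fin by (intro sum.union_disjoint) auto
  also have "(\<Sum>B\<in>insert H ` Pow A. monom ((- 1 :: int) ^ card B) (dim (S \<inter> \<Inter>B))) =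
      - whitney_poly (S \<inter> H) A"
    unfolding whitney_poly_def
    by (simp add: sum.reindex[OF inj] card sum_negf minus_monom[symmetric] Int_assoc)
  finally show ?thesis by simp
qed

text \<open>Since \<open>K\<close> does not cut \<open>S\<close>, deletion and restriction with
  respect to \<open>K\<close> give the same polynomial and cancel.\<close>

lemma whitney_poly_eq_0:
  assumes "finite A" "K \<in> A" "S \<subseteq> K"
  shows "whitney_poly S A = 0"
proof -
  have "S \<inter> K = S" using assms(3) by auto
  then show ?thesis
    using whitney_poly_insert[of "A - {K}" K S] assms(1,2) by (simp add: insert_absorb)
qed

definition hyperplane_transversal :: "'a::real_vector \<Rightarrow> 'a set \<Rightarrow> bool" where
  "hyperplane_transversal e H \<longleftrightarrow> (\<exists>f :: 'a \<Rightarrow> real. linear f \<and> f e \<noteq> 0 \<and> H = {v. f v = 0})"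

lemma hyperplane_transversal_subspace:
  "hyperplane_transversal e H \<Longrightarrow> subspace H"
  by (auto simp: hyperplane_transversal_def linear_subspace_kernel)

lemma hyperplane_transversal_notin:
  "hyperplane_transversal e H \<Longrightarrow> e \<notin> H"
  by (auto simp: hyperplane_transversal_def)

text \<open>As \<open>e\<close> lies in \<open>U\<close>, the projection onto \<open>H\<close> along
  \<open>e\<close> maps \<open>U\<close> into itself, so \<open>U\<close> is spanned by
  \<open>H \<inter> U\<close> and the one further vector \<open>e\<close>.\<close>

lemma dim_hyperplane_transversal:
  fixes e :: "'a::euclidean_space"
  assumes H: "hyperplane_transversal e H" and U: "subspace U" "e \<in> U"
  shows "dim U = Suc (dim (H \<inter> U))"
proof -
  obtain f :: "'a \<Rightarrow> real" where f: "linear f" "f e \<noteq> 0" "H = {v. f v = 0}"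
    using H by (auto simp: hyperplane_transversal_def)
  have HU: "subspace (H \<inter> U)"
    using H U by (simp add: hyperplane_transversal_subspace subspace_inter)
  have "span (insert e (H \<inter> U)) = U"
  proof
    show "span (insert e (H \<inter> U)) \<subseteq> U"
      using U by (intro span_minimal) auto
    show "U \<subseteq> span (insert e (H \<inter> U))"
    proof
      fix v assume v: "v \<in> U"
      let ?w = "v - (f v / f e) *\<^sub>R e"
      have "f ?w = 0"
        using f(1,2) by (simp add: linear_diff linear_scale)
      moreover have "?w \<in> U"
        using U v by (simp add: subspace_diff subspace_scale)
      ultimately have "?w \<in> span (H \<inter> U)"
        using f(3) by (simp add: span_base)
      then show "v \<in> span (insert e (H \<inter> U))"
        by (auto simp: span_insert)
    qed
  qed
  then have "dim U = dim (insert e (H \<inter> U))"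
    by (metis dim_span)
  moreover have "e \<notin> span (H \<inter> U)"
    using hyperplane_transversal_notin[OF H] HU by (simp add: span_eq_iff[THEN iffD2])
  ultimately show ?thesis
    by (simp add: dim_insert)
qed

text \<open>Every intersection of members of \<open>A\<close> contains \<open>e\<close>, so cutting
  it with \<open>H\<close> costs exactly one dimension, that is, one factor
  \<open>t = [:0, 1:]\<close>.\<close>

lemma whitney_poly_transversal:
  fixes A :: "'a::euclidean_space set set"
  assumes sub: "\<And>K. K \<in> A \<Longrightarrow> subspace K \<and> e \<in> K"
    and H: "hyperplane_transversal e H"
  shows "[:0, 1:] * whitney_poly H A = whitney_poly UNIV A"
proof -
  have "dim (\<Inter>B) = Suc (dim (H \<inter> \<Inter>B))" if "B \<in> Pow A" for B
  proof (rule dim_hyperplane_transversal[OF H])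
    show "subspace (\<Inter>B)" "e \<in> \<Inter>B"
      using that sub by (auto intro: subspace_Inter)
  qed
  then show ?thesis
    unfolding whitney_poly_def by (simp add: sum_distrib_left monom_Suc)
qed

text \<open>The factor \<open>(t - k) / t\<close> is stated with the denominator multiplied out.
  Each new \<open>H\<close> subtracts \<open>whitney_poly H A\<close>, which is
  \<open>whitney_poly UNIV A\<close> divided by \<open>t\<close>.\<close>

lemma whitney_poly_add_transversals:
  fixes A C :: "'a::euclidean_space set set"
  assumes fin: "finite A" "finite C"
    and sub: "\<And>K. K \<in> A \<Longrightarrow> subspace K \<and> e \<in> K"
    and trans: "\<And>H. H \<in> C \<Longrightarrow> hyperplane_transversal e H"
    and meet: "\<And>H H'. H \<in> C \<Longrightarrow> H' \<in> C \<Longrightarrow> H \<noteq> H' \<Longrightarrow> \<exists>K\<in>A. H \<inter> H' \<subseteq> K"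
  shows "[:0, 1:] * whitney_poly UNIV (A \<union> C) = [:- int (card C), 1:] * whitney_poly UNIV A"
  using fin(2) trans meet
proof (induction C rule: finite_induct)
  case (insert H C)
  note meet' = insert.prems(2)
  have notin: "H' \<notin> A" if "H' \<in> insert H C" for H'
    using hyperplane_transversal_notin[OF insert.prems(1)[OF that]] sub by blast
  \<comment> \<open>On \<open>H\<close> the other new hyperplanes do not matter: adding
    \<open>H'\<close> subtracts the polynomial on \<open>H \<inter> H'\<close>, which is zero
    because some \<open>K\<close> in \<open>A\<close> contains \<open>H \<inter> H'\<close>.\<close>
  have restrict: "whitney_poly H (A \<union> D) = whitney_poly H A" if "D \<subseteq> C" for D
    using finite_subset[OF that insert.hyps(1)] that
  proof (induction D rule: finite_induct)
    case (insert H' D)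
    then have "H' \<in> C" "H' \<noteq> H"
      using \<open>H \<notin> C\<close> by auto
    then obtain K where "K \<in> A" "H \<inter> H' \<subseteq> K"
      using meet'[of H H'] by auto
    then have "whitney_poly (H \<inter> H') (A \<union> D) = 0"
      using fin(1) insert.hyps(1) by (intro whitney_poly_eq_0[of _ K]) auto
    then show ?case
      using whitney_poly_insert[of "A \<union> D" H' H] notin[of H'] \<open>H' \<in> C\<close> insert fin(1) by simp
  qed simp
  have "whitney_poly UNIV (A \<union> insert H C) =
      whitney_poly UNIV (A \<union> C) - whitney_poly H A"
    using whitney_poly_insert[of "A \<union> C" H UNIV] notin[of H] insert.hyps fin(1) restrict[of C]
    by simp
  then have "[:0, 1:] * whitney_poly UNIV (A \<union> insert H C) =
      [:0, 1:] * whitney_poly UNIV (A \<union> C) - [:0, 1:] * whitney_poly H A"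
    by (simp only: right_diff_distrib)
  also have "[:0, 1:] * whitney_poly UNIV (A \<union> C) = [:- int (card C), 1:] * whitney_poly UNIV A"
    using insert.prems by (intro insert.IH) blast+
  also have "[:0, 1:] * whitney_poly H A = whitney_poly UNIV A"
    using sub insert.prems(1)[of H] by (intro whitney_poly_transversal) auto
  also have "[:- int (card C), 1:] * whitney_poly UNIV A - whitney_poly UNIV A =
      ([:- int (card C), 1:] - 1) * whitney_poly UNIV A"
    by (simp only: left_diff_distrib mult_1)
  also have "[:- int (card C), 1:] - 1 = [:- int (card (insert H C)), 1:]"
    using insert.hyps by (simp add: one_pCons)
  finally show ?case .
qed simp

text \<open>Iterates the previous step over blocks \<open>F 0, F 1, ...\<close>. The direction of a
  block has to lie only in \<open>A\<close> and in the earlier blocks; \<open>[:0, 1:] ^ m\<close>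
  collects the denominators.\<close>

lemma whitney_poly_tower:
  fixes A :: "'a::euclidean_space set set"
  assumes fin: "finite A" "\<And>i. i < m \<Longrightarrow> finite (F i)"
    and sub: "\<And>K. K \<in> A \<Longrightarrow> subspace K"
    and e: "\<And>i K. i < m \<Longrightarrow> K \<in> A \<union> (\<Union>j<i. F j) \<Longrightarrow> e i \<in> K"
    and trans: "\<And>i H. i < m \<Longrightarrow> H \<in> F i \<Longrightarrow> hyperplane_transversal (e i) H"
    and meet: "\<And>i H H'. i < m \<Longrightarrow> H \<in> F i \<Longrightarrow> H' \<in> F i \<Longrightarrow> H \<noteq> H' \<Longrightarrow>
      \<exists>K\<in>A \<union> (\<Union>j<i. F j). H \<inter> H' \<subseteq> K"
  shows "[:0, 1:] ^ m * whitney_poly UNIV (A \<union> (\<Union>i<m. F i)) =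
    (\<Prod>i<m. [:- int (card (F i)), 1:]) * whitney_poly UNIV A"
  using assms
proof (induction m)
  case (Suc m)
  let ?A = "A \<union> (\<Union>i<m. F i)"
  have step: "[:0, 1:] * whitney_poly UNIV (?A \<union> F m) =
      [:- int (card (F m)), 1:] * whitney_poly UNIV ?A"
  proof (rule whitney_poly_add_transversals[where e = "e m"])
    fix K assume "K \<in> ?A"
    then show "subspace K \<and> e m \<in> K"
      using Suc.prems(3,4,5) hyperplane_transversal_subspace
      by (metis UN_E Un_iff lessI lessThan_iff less_SucI)
  qed (use Suc.prems in \<open>auto simp: less_Suc_eq\<close>)
  have IH: "[:0, 1:] ^ m * whitney_poly UNIV ?A =
      (\<Prod>i<m. [:- int (card (F i)), 1:]) * whitney_poly UNIV A"
    using Suc.prems by (intro Suc.IH) (auto simp: less_Suc_eq)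
  have "A \<union> (\<Union>i<Suc m. F i) = ?A \<union> F m"
    by (auto simp: lessThan_Suc)
  then have "[:0, 1:] ^ Suc m * whitney_poly UNIV (A \<union> (\<Union>i<Suc m. F i)) =
      [:0, 1:] ^ m * ([:0, 1:] * whitney_poly UNIV (?A \<union> F m))"
    by (simp only: power_Suc2 mult.assoc)
  also have "\<dots> = [:- int (card (F m)), 1:] * ([:0, 1:] ^ m * whitney_poly UNIV ?A)"
    by (simp only: step mult.left_commute)
  finally show ?case
    by (simp only: IH prod.lessThan_Suc mult.assoc mult.commute mult.left_commute)
qed simp

section \<open>The homogenized Shi arrangement\<close>

theorem theorem5p1:
  fixes n :: nat and c :: "nat \<Rightarrow> 'd::finite"
  assumes "n \<ge> 1" and "bij_betw c {1..2 * n - 1} (UNIV :: 'd set)"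
  shows "characteristic_poly (homogenized_shi n c) =
    [:0, 1:] * (\<Prod>i = 1..n - 1. [:- int i, 1:] ^ 2)"
proof -
  define hx :: "nat \<Rightarrow> nat \<Rightarrow> (real ^ 'd) set"
    where "hx i j = {v. v $ c i - v $ c j = 0}" for i j
  define hy :: "nat \<Rightarrow> nat \<Rightarrow> (real ^ 'd) set"
    where "hy i j = {v. v $ c i - v $ c j = v $ c (n + i)}" for i j
  \<comment> \<open>Level \<open>k\<close> holds the hyperplanes with smaller index
    \<open>i = n - 1 - k\<close>, so \<open>i\<close> descends from \<open>n - 1\<close> to
    \<open>1\<close>.\<close>
  define X where "X k = hx (n - 1 - k) ` {n - 1 - k<..n}" for k
  define Y where "Y k = hy (n - 1 - k) ` {n - 1 - k<..n}" for k
  define AX where "AX = (\<Union>k<n - 1. X k)"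
  define e :: "nat \<Rightarrow> real ^ 'd" where "e i = axis (c i) 1" for i
  have e_nth: "e i $ c j = (if i = j then 1 else 0)" if "i \<in> {1..2 * n - 1}" "j \<in> {1..2 * n - 1}" for i j
    using that assms(2) by (auto simp: e_def axis_def bij_betw_def dest: inj_onD)
  have card_UNIV: "CARD('d) = 2 * n - 1"
    using bij_betw_same_card[OF assms(2)] by simp
  have transx: "hyperplane_transversal (e i) (hx i j)" if "1 \<le> i" "i < j" "j \<le> n" for i j
    unfolding hyperplane_transversal_def hx_def
    using that by (intro exI[of _ "\<lambda>v. v $ c i - v $ c j"]) (auto simp: e_nth algebra_simps intro!: linearI)
  have transy: "hyperplane_transversal (e (n + i)) (hy i j)" if "1 \<le> i" "i < j" "j \<le> n" for i j
    unfolding hyperplane_transversal_def hy_def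
    using that by (intro exI[of _ "\<lambda>v. v $ c i - v $ c j - v $ c (n + i)"])
      (auto simp: e_nth algebra_simps intro!: linearI)
  have mem_AX: "hx i j \<in> AX" if "1 \<le> i" "i < j" "j \<le> n" for i j
    unfolding AX_def X_def using that by (intro UN_I[of "n - 1 - i"] imageI) auto
  have AXE: "\<exists>i j. K = hx i j \<and> 1 \<le> i \<and> i < j \<and> j \<le> n" if "K \<in> AX" for K
    using that unfolding AX_def X_def by fastforce
  have AX: "[:0, 1:] ^ (n - 1) * whitney_poly UNIV ({} \<union> (\<Union>k<n - 1. X k)) =
      (\<Prod>k<n - 1. [:- int (card (X k)), 1:]) * whitney_poly UNIV ({} :: (real ^ 'd) set set)"
  proof (rule whitney_poly_tower[where e = "\<lambda>k. e (n - 1 - k)"])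
    fix k K assume k: "k < n - 1" and K: "K \<in> {} \<union> (\<Union>j<k. X j)"
    define m where "m = n - 1 - k"
    have m: "1 \<le> m" "m < n" using k by (auto simp: m_def)
    \<comment> \<open>Earlier levels involve only coordinates \<open>x\<close> with index above
      \<open>m\<close>, so the direction of \<open>x_m\<close> lies in all of them.\<close>
    obtain i j where "K = hx i j" "m < i" "i < j" "j \<le> n"
      using K k by (auto simp: X_def m_def)
    then show "e (n - 1 - k) \<in> K"
      unfolding m_def[symmetric] using m by (simp add: hx_def e_nth)
  next
    fix k H H' assume k: "k < n - 1" and H: "H \<in> X k" "H' \<in> X k" "H \<noteq> H'"
    let ?i = "n - 1 - k"
    obtain j j' where j: "H = hx ?i j" "?i < j" "j \<le> n" and j': "H' = hx ?i j'" "?i < j'" "j' \<le> n"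
      using H(1,2) unfolding X_def image_iff greaterThanAtMost_iff Bex_def by blast
    \<comment> \<open>Comparing the two equations gives \<open>x_j = x_j'\<close>. Its smaller index
      exceeds \<open>?i\<close>, so this hyperplane belongs to an earlier level.\<close>
    have "H \<inter> H' \<subseteq> hx (min j j') (max j j')"
      using j j' by (auto simp: hx_def min_def max_def)
    moreover have "j \<noteq> j'" using H j j' by auto
    then have "hx (min j j') (max j j') \<in> X (n - 1 - min j j')" "n - 1 - min j j' < k"
      using j j' k by (auto simp: X_def min_def max_def)
    ultimately show "\<exists>K\<in>{} \<union> (\<Union>j<k. X j). H \<inter> H' \<subseteq> K" by blast
  qed (auto simp: X_def intro!: transx)
  have AY: "[:0, 1:] ^ (n - 1) * whitney_poly UNIV (AX \<union> (\<Union>k<n - 1. Y k)) =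
      (\<Prod>k<n - 1. [:- int (card (Y k)), 1:]) * whitney_poly UNIV AX"
  proof (rule whitney_poly_tower[where e = "\<lambda>k. e (n + (n - 1 - k))"])
    fix K assume "K \<in> AX"
    then show "subspace K"
      using AXE transx hyperplane_transversal_subspace by metis
  next
    fix k K assume k: "k < n - 1" and K: "K \<in> AX \<union> (\<Union>j<k. Y j)"
    define m where "m = n - 1 - k"
    have m: "1 \<le> m" "m < n" using k by (auto simp: m_def)
    \<comment> \<open>The \<open>hx\<close> hyperplanes involve no \<open>y\<close>, and the earlier
      \<open>hy\<close> levels only \<open>y_i\<close> with \<open>i > m\<close>, so the direction
      of \<open>y_m\<close> lies in all of them.\<close>
    consider i j where "K = hx i j" "1 \<le> i" "i < j" "j \<le> n"
      | i j where "K = hy i j" "m < i" "i < j" "j \<le> n"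
      using AXE[of K] K k by (auto simp: Y_def m_def)
    then show "e (n + (n - 1 - k)) \<in> K"
      unfolding m_def[symmetric] using m by cases (simp_all add: hx_def hy_def e_nth)
  next
    fix k H H' assume k: "k < n - 1" and H: "H \<in> Y k" "H' \<in> Y k" "H \<noteq> H'"
    let ?i = "n - 1 - k"
    obtain j j' where j: "H = hy ?i j" "?i < j" "j \<le> n" and j': "H' = hy ?i j'" "?i < j'" "j' \<le> n"
      using H(1,2) unfolding Y_def image_iff greaterThanAtMost_iff Bex_def by blast
    \<comment> \<open>Both equations have the same right-hand side \<open>y_i\<close>, so it cancels
      and again \<open>x_j = x_j'\<close>, now a member of \<open>AX\<close>.\<close>
    have "H \<inter> H' \<subseteq> hx (min j j') (max j j')"
      using j j' by (auto simp: hx_def hy_def min_def max_def)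
    moreover have "j \<noteq> j'" using H j j' by auto
    then have "hx (min j j') (max j j') \<in> AX"
      using j j' k by (intro mem_AX) (auto simp: min_def max_def)
    ultimately show "\<exists>K\<in>AX \<union> (\<Union>j<k. Y j). H \<inter> H' \<subseteq> K" by blast
  next
    fix k H assume k: "k < n - 1" and "H \<in> Y k"
    then obtain j where "H = hy (n - 1 - k) j" "n - 1 - k < j" "j \<le> n"
      by (auto simp: Y_def)
    then show "hyperplane_transversal (e (n + (n - 1 - k))) H"
      using k transy[of "n - 1 - k" j] by simp
  qed (auto simp: Y_def AX_def X_def)
  have cardX: "card (X k) = Suc k" if k: "k < n - 1" for k
  proof -
    define m where "m = n - 1 - k"
    have m: "1 \<le> m" "m < n" using k by (auto simp: m_def)
    \<comment> \<open>The basis vector \<open>e j\<close> tells \<open>hx m j\<close> from the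
      others, which leaves \<open>n - m = Suc k\<close> distinct hyperplanes.\<close>
    have "inj_on (hx m) {m<..n}"
    proof (rule inj_onI, rule ccontr)
      fix j j' assume j: "j \<in> {m<..n}" "j' \<in> {m<..n}" "j \<noteq> j'" and eq: "hx m j = hx m j'"
      have "e j \<in> hx m j'" "e j \<notin> hx m j"
        using j m by (auto simp: hx_def e_nth)
      with eq show False by simp
    qed
    then show ?thesis
      using k by (simp add: X_def m_def card_image)
  qed
  have cardY: "card (Y k) = Suc k" if k: "k < n - 1" for k
  proof -
    define m where "m = n - 1 - k"
    have m: "1 \<le> m" "m < n" using k by (auto simp: m_def)
    have "inj_on (hy m) {m<..n}"
    proof (rule inj_onI, rule ccontr)
      fix j j' assume j: "j \<in> {m<..n}" "j' \<in> {m<..n}" "j \<noteq> j'" and eq: "hy m j = hy m j'"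
      have "e j \<in> hy m j'" "e j \<notin> hy m j"
        using j m by (auto simp: hy_def e_nth)
      with eq show False by simp
    qed
    then show ?thesis
      using k by (simp add: Y_def m_def card_image)
  qed
  let ?A = "homogenized_shi n c"
  have A_iff: "H \<in> ?A \<longleftrightarrow> (\<exists>i j. (H = hx i j \<or> H = hy i j) \<and> 1 \<le> i \<and> i < j \<and> j \<le> n)" for H
    unfolding homogenized_shi_def hx_def hy_def by blast
  have A: "?A = AX \<union> (\<Union>k<n - 1. Y k)"
  proof (intro equalityI subsetI)
    fix H assume "H \<in> ?A"
    then obtain i j where ij: "H = hx i j \<or> H = hy i j" "1 \<le> i" "i < j" "j \<le> n"
      using A_iff by blast
    moreover have "hy i j \<in> Y (n - 1 - i)" "n - 1 - i < n - 1"
      using ij by (auto simp: Y_def)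
    ultimately show "H \<in> AX \<union> (\<Union>k<n - 1. Y k)"
      using mem_AX by blast
  next
    fix H assume "H \<in> AX \<union> (\<Union>k<n - 1. Y k)"
    then show "H \<in> ?A"
      using AXE[of H] unfolding A_iff by (fastforce simp: Y_def)
  qed
  have trans: "\<exists>e. hyperplane_transversal e H" if "H \<in> ?A" for H
    using that A_iff transx transy by metis
  have chi: "characteristic_poly ?A = whitney_poly UNIV ?A"
  proof (rule characteristic_poly_central[OF finite_homogenized_shi])
    show "UNIV \<notin> ?A"
      using trans hyperplane_transversal_notin by blast
    show "subspace H" if "H \<in> ?A" for H
      using trans[OF that] hyperplane_transversal_subspace by blast
  qed
  define T :: "int poly" where "T = [:0, 1:] ^ (n - 1)"
  define P where "P = (\<Prod>i = 1..n - 1. [:- int i, 1:])"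
  \<comment> \<open>The level sizes \<open>Suc k\<close> for \<open>k < n - 1\<close> are exactly
    \<open>1, ..., n - 1\<close>.\<close>
  have "(\<Prod>k<n - 1. [:- int (card (X k)), 1:]) = P"
    "(\<Prod>k<n - 1. [:- int (card (Y k)), 1:]) = P"
    unfolding P_def using cardX cardY by (simp_all add: prod.atLeast1_atMost_eq)
  with AX AY have AX: "T * whitney_poly UNIV AX = P * whitney_poly UNIV ({} :: (real ^ 'd) set set)"
    and AY: "T * whitney_poly UNIV ?A = P * whitney_poly UNIV AX"
    unfolding A T_def AX_def[symmetric] Un_empty_left by simp_all
  \<comment> \<open>The empty arrangement contributes \<open>t ^ (2 * n - 1)\<close>: the two towers
    consume one factor \<open>T\<close> each, and a single \<open>t\<close> remains. The split of
    the exponent needs \<open>n \<ge> 1\<close> because subtraction truncates.\<close>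
  have "2 * n - 1 = (n - 1) + Suc (n - 1)" using assms(1) by simp
  then have "[:0, 1:] ^ (2 * n - 1) = T * (T * [:0, 1:])"
    unfolding T_def by (simp only: power_add power_Suc2)
  then have empty: "whitney_poly UNIV ({} :: (real ^ 'd) set set) = T * (T * [:0, 1:])"
    by (simp add: whitney_poly_def card_UNIV monom_altdef)
  have "T * (T * characteristic_poly ?A) = P * (T * whitney_poly UNIV AX)"
    by (simp only: chi AY mult.left_commute)
  also have "\<dots> = T * (T * ([:0, 1:] * (P * P)))"
    by (simp only: AX empty mult.assoc mult.commute mult.left_commute)
  finally have "T * (T * characteristic_poly ?A) = T * (T * ([:0, 1:] * (P * P)))" .
  moreover have "T \<noteq> 0" by (simp add: T_def)
  ultimately have "characteristic_poly ?A = [:0, 1:] * (P * P)"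
    by (metis mult_left_cancel)
  then show ?thesis
    unfolding P_def by (simp only: power2_eq_square prod.distrib)
qed

end
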